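(* Let $\nu,\eta,\beta\in(0,1)$ with $\nu=\eta\,\beta$, and let $M_\nu(x;t)$, $M_\eta(x;t)$, $M_\beta(x;t)$ be the (time-dependent) $M$-Wright functions of orders $\nu,\eta,\beta$, respectively. Then for all $0<x<\infty$ and $t>0$, $$M_\nu(x;t)=\int_0^\infty M_\eta(x;\tau)\,M_\beta(\tau;t)\,d\tau .$$
   Context: For $\nu\in(0,1)$ the $M$-Wright function of order $\nu$ is the entire function $$M_\nu(z)=\sum_{n=0}^\infty\frac{(-z)^n}{n!\,\Gamma[-\nu n+(1-\nu)]},\qquad z\in\mathbb C,$$ where $1/\Gamma$ is taken to be $0$ at the poles of $\Gamma$. For $x>0$ and $t>0$ the time-dependent $M$-Wright function is $$M_\nu(x;t):=t^{-\nu}M_\nu\left(\frac{x}{t^\nu}\right).$$ *)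

theory Defs
  imports "HOL-Analysis.Analysis"
begin

text \<open>The reciprocal Gamma function \<^const>\<open>rGamma\<close> is entire and vanishes exactly at the
  poles of \<^const>\<open>Gamma\<close>, which is the required convention for \<open>1/\<Gamma>\<close>.\<close>

definition M_Wright :: "real \<Rightarrow> complex \<Rightarrow> complex" where
  "M_Wright \<nu> z =
     (\<Sum>n. (- z) ^ n / fact n * rGamma (complex_of_real (- \<nu> * real n + (1 - \<nu>))))"

text \<open>The values are real for real arguments, but they are kept in \<^typ>\<open>complex\<close>, as values
  of the entire function above. The intended domain is \<open>x > 0\<close>, \<open>t > 0\<close>.\<close>

definition M_Wright_time :: "real \<Rightarrow> real \<Rightarrow> real \<Rightarrow> complex" where
  "M_Wright_time \<nu> x t =
     complex_of_real (t powr (- \<nu>)) * M_Wright \<nu> (complex_of_real (x / t powr \<nu>))"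

end

theory Submission
  imports Defs "HOL-Complex_Analysis.Complex_Analysis" "HOL-Real_Asymp.Real_Asymp"
begin

text \<open>Integrating the exponential series termwise against Hankel's integral for \<open>1/\<Gamma>\<close> gives
  \<open>M\<^sub>\<nu>(x;t) = 1/(2\<pi>i) \<integral> exp(t\<sigma> - x\<sigma>\<^sup>\<nu>) \<sigma>\<^bsup>\<nu>-1\<^esup> d\<sigma>\<close> along the two rays \<open>arg \<sigma> = \<plusminus>\<phi>\<close>, for any
  \<open>\<pi>/2 < \<phi> < \<pi>\<close>. Inserting this into the Laplace integral of \<open>M\<^sub>\<eta>(x;\<cdot>)\<close> leaves a Cauchy kernel
  \<open>1/(s - \<sigma>)\<close>, and if \<open>\<eta>\<phi> < \<pi>/2\<close> closing the rays to the right picks up the residue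
  \<open>s\<^bsup>\<eta>-1\<^esup> exp(-x s\<^sup>\<eta>)\<close>. If also \<open>\<beta>\<phi> < \<pi>/2\<close>, Fubini applies to the representation of
  \<open>M\<^sub>\<beta>(\<tau>;t)\<close>: the \<open>\<tau>\<close>-integral is this Laplace transform at \<open>s = \<sigma>\<^sup>\<beta>\<close>, and what remains is the
  representation of \<open>M\<^bsub>\<eta>\<beta>\<^esub>(x;t)\<close>. Logarithmic coordinates \<open>\<sigma> = e\<^sup>w\<close>, \<open>\<tau> = e\<^sup>y\<close> turn the rays into the
  horizontal lines \<open>Im w = \<plusminus>\<phi>\<close> and remove the branch cut.\<close>

section \<open>Gamma integrals in logarithmic coordinates\<close>

lemma exp_tendsto_PInf_ereal:
  "((ereal \<circ> exp \<circ> real_of_ereal) \<longlongrightarrow> \<infinity>) (at_left \<infinity>)"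
  unfolding ereal_tendsto_simps unfolding comp_def
  by (auto simp: ereal_tendsto_simps tendsto_PInfty_eq_at_top intro!: exp_at_top)

lemma exp_tendsto_zero_ereal:
  "((ereal \<circ> exp \<circ> real_of_ereal) \<longlongrightarrow> 0) (at_right (-\<infinity>))"
  unfolding ereal_tendsto_simps unfolding comp_def zero_ereal_def
  by (intro tendsto_ereal exp_at_bot)

text \<open>The substitution rule for complex integrands asks for integrability on both sides. The
  nonnegative rule, applied to \<open>norm (f x)\<close>, first carries integrability from the line
  over to the ray.\<close>

lemma set_integral_exp_subst:
  fixes f :: "real \<Rightarrow> complex"
  assumes cont: "continuous_on {0<..} f"
    and int: "integrable lborel (\<lambda>y. of_real (exp y) * f (exp y))"
  shows "set_integrable lborel {0<..} f"
    and "(LINT x:{0<..}|lborel. f x) = (LINT y|lborel. of_real (exp y) * f (exp y))"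
proof -
  have c: "isCont f (exp x)" for x
    using cont by (simp add: continuous_on_eq_continuous_at)
  have e: "einterval (-\<infinity>) \<infinity> = UNIV" "einterval 0 \<infinity> = {0<..}"
    by (auto simp: einterval_def zero_ereal_def)
  have i: "set_integrable lborel UNIV (\<lambda>x. norm (f (exp x)) * exp x)"
    using integrable_norm[OF int] by (simp add: set_integrable_def norm_mult mult.commute)
  have "set_integrable lborel (einterval 0 \<infinity>) (\<lambda>x. norm (f x))"
    by (rule interval_integral_substitution_nonneg(1)[where g=exp and g'=exp and a="-\<infinity>" and b="\<infinity>"])
      (use c i in \<open>auto simp: e intro!: derivative_eq_intros continuous_intros exp_tendsto_zero_ereal exp_tendsto_PInf_ereal\<close>)
  then have n: "integrable lborel (\<lambda>x. indicator {0<..} x *\<^sub>R norm (f x))"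
    by (simp add: e set_integrable_def)
  have m: "(\<lambda>x. indicator {0<..} x *\<^sub>R f x) \<in> borel_measurable borel"
    using cont by (intro borel_measurable_continuous_on_indicator) auto
  show s: "set_integrable lborel {0<..} f"
    unfolding set_integrable_def
    by (rule Bochner_Integration.integrable_bound[OF n]) (use m in \<open>auto simp: indicator_def\<close>)
  have "(LBINT x=0..\<infinity>. f x) = (LBINT x=-\<infinity>..\<infinity>. exp x *\<^sub>R f (exp x))"
    by (rule interval_integral_substitution_integrable[where g=exp and g'=exp])
      (use c int s in \<open>auto simp: e set_integrable_def scaleR_conv_of_real intro!: derivative_eq_intros continuous_intros exp_tendsto_zero_ereal exp_tendsto_PInf_ereal\<close>)
  then show "(LINT x:{0<..}|lborel. f x) = (LINT y|lborel. of_real (exp y) * f (exp y))"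
    by (simp add: interval_lebesgue_integral_def e set_lebesgue_integral_def scaleR_conv_of_real)
qed

text \<open>Euler's integral after \<open>t = exp u\<close>. The substitution is run with
  \<open>ln\<close> as the inner function, so that the known integrability of Euler's integrand on
  the ray yields that of the new integrand on the line.\<close>

lemma has_bochner_integral_exp_minus_exp:
  fixes a :: real
  assumes "0 < a"
  shows "has_bochner_integral lborel (\<lambda>u. exp (a * u - exp u)) (Gamma a)"
proof -
  have e: "einterval (-\<infinity>) \<infinity> = UNIV" "einterval 0 \<infinity> = {0<..}"
    by (auto simp: einterval_def zero_ereal_def)
  have eq: "exp (a * ln x - exp (ln x)) * (1 / x) = x powr (a - 1) / exp x" if "x > 0" for x::real
    using that by (simp add: powr_def exp_diff left_diff_distrib field_simps)
  have L0: "((ereal \<circ> ln \<circ> real_of_ereal) \<longlongrightarrow> -\<infinity>) (at_right 0)"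
    unfolding zero_ereal_def ereal_tendsto_simps unfolding comp_def
    using ln_at_0 by (auto simp: tendsto_MInfty filterlim_at_bot_dense)
  have L1: "((ereal \<circ> ln \<circ> real_of_ereal) \<longlongrightarrow> \<infinity>) (at_left \<infinity>)"
    unfolding ereal_tendsto_simps unfolding comp_def
    by (auto simp: tendsto_PInfty_eq_at_top ereal_tendsto_simps intro!: ln_at_top)
  have nn: "(\<integral>\<^sup>+ t. ennreal (indicator {0..} t * t powr (a - 1) / exp t) \<partial>lborel) = Gamma a"
    using Gamma_conv_nn_integral_real[OF assms] by simp
  have "has_bochner_integral lborel (\<lambda>t. indicator {0..} t * t powr (a - 1) / exp t) (Gamma a)"
    by (rule has_bochner_integral_nn_integral) (use nn assms in \<open>auto intro: Gamma_real_pos less_imp_le\<close>)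
  moreover have "indicator {0..} t * t powr (a - 1) / exp t
      = indicator {0<..} t *\<^sub>R (exp (a * ln t - exp (ln t)) * (1 / t))" for t
    using eq[of t] by (cases "t = 0") (auto simp: indicator_def)
  ultimately have hb: "has_bochner_integral lborel
      (\<lambda>t. indicator {0<..} t *\<^sub>R (exp (a * ln t - exp (ln t)) * (1 / t))) (Gamma a)"
    by simp
  have dom: "0 < ereal x \<longleftrightarrow> 0 < x" "0 \<le> ereal x \<longleftrightarrow> 0 \<le> x" for x by auto
  have h: "\<And>x. 0 < ereal x \<Longrightarrow> ereal x < \<infinity> \<Longrightarrow> DERIV ln x :> 1 / x"
     "\<And>x. 0 < ereal x \<Longrightarrow> ereal x < \<infinity> \<Longrightarrow> isCont (\<lambda>u. exp (a * u - exp u)) (ln x)"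
     "\<And>x. 0 < ereal x \<Longrightarrow> ereal x < \<infinity> \<Longrightarrow> isCont (\<lambda>x::real. 1 / x) x"
     "\<And>x. 0 < ereal x \<Longrightarrow> ereal x < \<infinity> \<Longrightarrow> 0 \<le> exp (a * ln x - exp (ln x))"
     "\<And>x. 0 \<le> ereal x \<Longrightarrow> ereal x \<le> \<infinity> \<Longrightarrow> 0 \<le> 1 / x"
    by (auto simp: dom intro!: derivative_eq_intros continuous_intros)
  have si: "set_integrable lborel (einterval 0 \<infinity>) (\<lambda>x. exp (a * ln x - exp (ln x)) * (1 / x))"
    using hb by (simp add: e set_integrable_def has_bochner_integral_iff)
  note sub = interval_integral_substitution_nonneg[where g=ln and g'="\<lambda>x. 1/x" and a=0 and b="\<infinity>"
      and f="\<lambda>u. exp (a * u - exp u)", OF _ h L0 L1 si]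
  have "integrable lborel (\<lambda>u. exp (a * u - exp u))"
    using sub(1) by (simp add: e set_integrable_def)
  moreover have "(LINT u|lborel. exp (a * u - exp u)) = Gamma a"
    using sub(2) hb
    by (simp add: e interval_lebesgue_integral_def set_lebesgue_integral_def has_bochner_integral_iff)
  ultimately show ?thesis by (simp add: has_bochner_integral_iff)
qed

text \<open>The scale \<open>k\<close> is a translation by \<open>ln k\<close> in logarithmic
  coordinates; it contributes the factor \<open>k powr (-a)\<close>.\<close>

lemma has_bochner_integral_exp_exp_Gamma:
  fixes a k :: real
  assumes "0 < a" "0 < k"
  shows "has_bochner_integral lborel (\<lambda>u. exp (a * u - k * exp u)) (Gamma a * k powr (-a))"
proof -
  have "has_bochner_integral lborel (\<lambda>u. exp (a * (ln k + 1 * u) - exp (ln k + 1 * u))) (Gamma a /\<^sub>R \<bar>1\<bar>)"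
    by (rule lborel_has_bochner_integral_real_affine_iff[THEN iffD1])
      (use has_bochner_integral_exp_minus_exp[OF assms(1)] in auto)
  then have "has_bochner_integral lborel (\<lambda>u. k powr (-a) * exp (a * (ln k + u) - k * exp u)) (k powr (-a) * Gamma a)"
    using assms by (intro has_bochner_integral_mult_right) (simp add: exp_add)
  moreover have "k powr (-a) * exp (a * (ln k + u) - k * exp u) = exp (a * u - k * exp u)" for u
    using assms by (simp add: powr_def exp_add[symmetric] algebra_simps)
  ultimately show ?thesis by (simp add: mult.commute)
qed

section \<open>Contour integrals between two horizontal lines\<close>

lemma contour_integral_linepath_same_Im:
  assumes "a < b" and int: "(\<lambda>x. f (Complex x c)) integrable_on {a..b}"
  shows "contour_integral (linepath (Complex a c) (Complex b c)) f
    = integral {a..b} (\<lambda>x. f (Complex x c))"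
proof -
  define g where "g = (\<lambda>x. f (Complex x c))"
  have "((\<lambda>x. g ((b - a) * x + a)) has_integral integral {a..b} g /\<^sub>R (b - a))
      ((\<lambda>x. (1 / (b - a)) *\<^sub>R x + - ((1 / (b - a)) *\<^sub>R a)) ` cbox a b)"
    using has_integral_affinity[of g "integral {a..b} g" a b "b - a" a] assms
    by (simp add: inverse_eq_divide integrable_integral g_def)
  moreover have "((\<lambda>x. (1 / (b - a)) *\<^sub>R x + - ((1 / (b - a)) *\<^sub>R a)) ` cbox a b) = {0..1}"
    using assms by (subst image_affinity_cbox) (auto simp: diff_divide_distrib[symmetric])
  ultimately have 1: "integral {0..1} (\<lambda>x. g ((b - a) * x + a)) = integral {a..b} g /\<^sub>R (b - a)"
    by (simp add: integral_unique)
  have "linepath (Complex a c) (Complex b c) x = Complex ((b - a) * x + a) c" for x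
    by (simp add: linepath_def complex_eq_iff algebra_simps)
  moreover have "Complex b c - Complex a c = of_real (b - a)"
    by (simp add: complex_eq_iff)
  ultimately have "contour_integral (linepath (Complex a c) (Complex b c)) f
      = integral {0..1} (\<lambda>x. g ((b - a) * x + a) * of_real (b - a))"
    by (simp add: contour_integral_integral g_def)
  also have "\<dots> = integral {0..1} (\<lambda>x. g ((b - a) * x + a)) * of_real (b - a)"
    by (rule integral_mult_left)
  also have "\<dots> = integral {a..b} g"
    unfolding 1 using assms by (simp add: scaleR_conv_of_real flip: of_real_diff)
  finally show ?thesis by (simp add: g_def)
qed

lemma tendsto_integral_symmetric_intervals:
  fixes f :: "real \<Rightarrow> complex"
  assumes "integrable lborel f"
  shows "((\<lambda>R. integral {-R..R} f) \<longlongrightarrow> (LINT x|lborel. f x)) at_top"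
proof -
  have m: "f \<in> borel_measurable borel"
    using assms by auto
  have "((\<lambda>R. LINT x|lborel. indicator {-R..R} x *\<^sub>R f x) \<longlongrightarrow> (LINT x|lborel. f x)) at_top"
  proof (rule integral_dominated_convergence_at_top[where w="\<lambda>x. norm (f x)"])
    show "AE x in lborel. ((\<lambda>R. indicator {-R..R} x *\<^sub>R f x) \<longlongrightarrow> f x) at_top"
    proof (rule AE_I2)
      fix x :: real
      have "\<forall>\<^sub>F R in at_top. indicator {-R..R} x *\<^sub>R f x = f x"
        using eventually_ge_at_top[of "\<bar>x\<bar>"] by eventually_elim (auto simp: indicator_def)
      then show "((\<lambda>R. indicator {-R..R} x *\<^sub>R f x) \<longlongrightarrow> f x) at_top"
        by (rule tendsto_eventually)
    qed
    show "\<forall>\<^sub>F R in at_top. AE x in lborel. norm (indicator {-R..R} x *\<^sub>R f x) \<le> norm (f x)"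
      by (auto simp: indicator_def)
  qed (use assms m in auto)
  moreover have "(LINT x|lborel. indicator {-R..R} x *\<^sub>R f x) = integral {-R..R} f" for R
  proof -
    have "set_integrable lborel {-R..R} f"
      unfolding set_integrable_def using assms by (intro integrable_mult_indicator) auto
    from set_borel_integral_eq_integral(2)[OF this] show ?thesis
      by (simp add: set_lebesgue_integral_def)
  qed
  ultimately show ?thesis by simp
qed

text \<open>The contour integral over the rectangle is bottom minus top plus two vertical sides, and
  the sides vanish as the rectangle widens. The value \<open>c\<close> is left free: it is 0 where
  Cauchy's theorem applies and a residue term where a pole is enclosed.\<close>

lemma horizontal_integral_difference:
  fixes g :: "complex \<Rightarrow> complex"
  assumes "v0 < v1"
    and int0: "integrable lborel (\<lambda>u. g (Complex u v0))"
    and int1: "integrable lborel (\<lambda>u. g (Complex u v1))"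
    and rect: "\<forall>\<^sub>F R in at_top. (g has_contour_integral c) (rectpath (Complex (-R) v0) (Complex R v1))"
    and bound: "\<forall>\<^sub>F R in at_top. \<forall>v\<in>{v0..v1}. norm (g (Complex R v)) \<le> B R \<and> norm (g (Complex (-R) v)) \<le> B R"
    and B: "(B \<longlongrightarrow> 0) at_top"
  shows "(LINT u|lborel. g (Complex u v0)) - (LINT u|lborel. g (Complex u v1)) = c"
proof -
  define D where "D R = integral {-R..R} (\<lambda>u. g (Complex u v0)) - integral {-R..R} (\<lambda>u. g (Complex u v1))" for R
  have 1: "(D \<longlongrightarrow> (LINT u|lborel. g (Complex u v0)) - (LINT u|lborel. g (Complex u v1))) at_top"
    unfolding D_def by (intro tendsto_diff tendsto_integral_symmetric_intervals int0 int1)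
  \<comment> \<open>\<open>D R\<close> collects the horizontal sides, so the error consists of the
    two vertical ones, each of length \<open>v1 - v0\<close>.\<close>
  have "\<forall>\<^sub>F R in at_top. norm (D R - c) \<le> 2 * B R * (v1 - v0)"
    using rect bound eventually_gt_at_top[of 0]
  proof eventually_elim
    case (elim R)
    define p1 p2 p3 p4 where "p1 = Complex (-R) v0" and "p2 = Complex R v0" and "p3 = Complex R v1" and "p4 = Complex (-R) v1"
    have io: "(\<lambda>u. g (Complex u v)) integrable_on {-R..R}" if "integrable lborel (\<lambda>u. g (Complex u v))" for v
      using integrable_on_lborel[OF that] integrable_on_subinterval by blast
    have ci: "(g has_contour_integral c) (linepath p1 p2 +++ linepath p2 p3 +++ linepath p3 p4 +++ linepath p4 p1)"
      using elim(1) by (simp add: rectpath_def Let_def p1_def p2_def p3_def p4_def)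
    have i: "g contour_integrable_on linepath p1 p2" "g contour_integrable_on linepath p2 p3"
      "g contour_integrable_on linepath p3 p4" "g contour_integrable_on linepath p4 p1"
      using has_contour_integral_integrable[OF ci] by simp_all
    have c: "c = contour_integral (linepath p1 p2) g + (contour_integral (linepath p2 p3) g
        + (contour_integral (linepath p3 p4) g + contour_integral (linepath p4 p1) g))"
      using contour_integral_unique[OF ci] i by simp
    have h: "contour_integral (linepath p1 p2) g = integral {-R..R} (\<lambda>u. g (Complex u v0))"
      unfolding p1_def p2_def using elim io[OF int0] by (intro contour_integral_linepath_same_Im) auto
    \<comment> \<open>The top side is traversed from right to left, hence the minus sign.\<close>
    have h': "contour_integral (linepath p3 p4) g = - integral {-R..R} (\<lambda>u. g (Complex u v1))"
      using contour_integral_reversepath[of "linepath p4 p3" g] elim io[OF int1]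
      by (simp add: p3_def p4_def contour_integral_linepath_same_Im)
    have B0: "0 \<le> B R" 
    proof -
      have "norm (g (Complex R v0)) \<le> B R" using elim(2) assms(1) by auto
      then show ?thesis by (rule order_trans[OF norm_ge_zero])
    qed
    have vd: "norm (p3 - p2) = v1 - v0" "norm (p1 - p4) = v1 - v0"
      using assms(1) by (auto simp: p1_def p2_def p3_def p4_def cmod_def)
    have seg: "closed_segment p2 p3 \<subseteq> {z. Re z = R \<and> Im z \<in> {v0..v1}}" "closed_segment p4 p1 \<subseteq> {z. Re z = -R \<and> Im z \<in> {v0..v1}}"
      using assms(1) by (auto simp: p1_def p2_def p3_def p4_def closed_segment_same_Re closed_segment_eq_real_ivl)
    have n1: "norm (contour_integral (linepath p2 p3) g) \<le> B R * norm (p3 - p2)"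
    proof (rule contour_integral_bound_linepath[OF i(2) B0])
      fix z assume "z \<in> closed_segment p2 p3"
      then have "z = Complex R (Im z)" "Im z \<in> {v0..v1}" using seg by (auto simp: complex_eq_iff)
      with elim(2)[rule_format, of "Im z"] show "norm (g z) \<le> B R" by simp
    qed
    have n2: "norm (contour_integral (linepath p4 p1) g) \<le> B R * norm (p1 - p4)"
    proof (rule contour_integral_bound_linepath[OF i(4) B0])
      fix z assume "z \<in> closed_segment p4 p1"
      then have "z = Complex (-R) (Im z)" "Im z \<in> {v0..v1}" using seg by (auto simp: complex_eq_iff)
      with elim(2)[rule_format, of "Im z"] show "norm (g z) \<le> B R" by simp
    qed
    have "D R - c = - (contour_integral (linepath p2 p3) g + contour_integral (linepath p4 p1) g)"
      unfolding c D_def h h' by simp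
    also have "norm \<dots> \<le> B R * (v1 - v0) + B R * (v1 - v0)"
      unfolding norm_minus_cancel using n1 n2 unfolding vd by (rule norm_triangle_mono)
    finally show ?case by simp
  qed
  moreover have "((\<lambda>R. 2 * B R * (v1 - v0)) \<longlongrightarrow> 0) at_top"
    using B by (auto intro!: tendsto_eq_intros)
  ultimately have "((\<lambda>R. D R - c) \<longlongrightarrow> 0) at_top"
    by (rule Lim_null_comparison)
  then have "(D \<longlongrightarrow> c) at_top" by (simp add: LIM_zero_cancel)
  from tendsto_unique[OF _ 1 this] show ?thesis by simp
qed

section \<open>Growth estimates and the Gamma integral with complex scale\<close>

text \<open>Since \<open>\<nu> < 1\<close>, \<open>exp (\<nu> * u)\<close> is of lower order than
  \<open>exp u\<close>. Only half of \<open>c\<close> is spent on it, so the other half still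
  provides decay.\<close>

lemma exp_scaled_le_half_exp:
  fixes c \<nu> A :: real
  assumes "0 < c" "0 < \<nu>" "\<nu> < 1"
  obtains D where "\<And>u. A * exp (\<nu> * u) \<le> D + c / 2 * exp u"
proof
  fix u :: real
  \<comment> \<open>Beyond \<open>u0\<close> the ratio \<open>exp ((1 - \<nu>) * u)\<close> exceeds
    \<open>2 * \<bar>A\<bar> / c\<close>. The summand 1 keeps the argument of \<open>ln\<close>
    positive when \<open>A = 0\<close>.\<close>
  define u0 where "u0 = ln (2 * \<bar>A\<bar> / c + 1) / (1 - \<nu>)"
  have pos: "0 < 2 * \<bar>A\<bar> / c + 1" using assms by (simp add: add_nonneg_pos)
  have "A * exp (\<nu> * u) \<le> \<bar>A\<bar> * exp (\<nu> * u)" by (simp add: mult_right_mono)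
  also have "\<dots> \<le> \<bar>A\<bar> * exp (\<nu> * u0) + c / 2 * exp u"
  proof (cases "u \<le> u0")
    case True
    then have "\<bar>A\<bar> * exp (\<nu> * u) \<le> \<bar>A\<bar> * exp (\<nu> * u0)"
      using assms by (intro mult_left_mono) auto
    moreover have "0 \<le> c / 2 * exp u" using assms by simp
    ultimately show ?thesis by linarith
  next
    case False
    then have "ln (2 * \<bar>A\<bar> / c + 1) \<le> (1 - \<nu>) * u"
      using assms by (simp add: u0_def field_simps)
    then have "2 * \<bar>A\<bar> / c + 1 \<le> exp ((1 - \<nu>) * u)"
      using pos by (metis exp_le_cancel_iff exp_ln)
    then have "2 * \<bar>A\<bar> / c \<le> exp ((1 - \<nu>) * u)" by simp
    then have "\<bar>A\<bar> \<le> c / 2 * exp ((1 - \<nu>) * u)"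
      using assms by (simp add: field_simps)
    then have "\<bar>A\<bar> * exp (\<nu> * u) \<le> c / 2 * exp ((1 - \<nu>) * u) * exp (\<nu> * u)"
      by (rule mult_right_mono) simp
    also have "\<dots> = c / 2 * exp u" by (simp add: exp_add[symmetric] algebra_simps)
    finally show ?thesis by (simp add: add_increasing)
  qed
  finally show "A * exp (\<nu> * u) \<le> \<bar>A\<bar> * exp (\<nu> * u0) + c / 2 * exp u" .
qed

lemma integrable_exp_subexponential:
  fixes c \<nu> A :: real
  assumes "0 < c" "0 < \<nu>" "\<nu> < 1"
  shows "integrable lborel (\<lambda>u. exp (A * exp (\<nu> * u) + \<nu> * u - c * exp u))"
proof -
  obtain D where D: "\<And>u. A * exp (\<nu> * u) \<le> D + c / 2 * exp u"
    using exp_scaled_le_half_exp[OF assms] by blast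
  have "integrable lborel (\<lambda>u. exp D * exp (\<nu> * u - c / 2 * exp u))"
    using has_bochner_integral_exp_exp_Gamma[of \<nu> "c/2"] assms
    by (intro integrable_mult_right) (auto simp: has_bochner_integral_iff)
  then show ?thesis
  proof (rule Bochner_Integration.integrable_bound)
    show "AE u in lborel. norm (exp (A * exp (\<nu> * u) + \<nu> * u - c * exp u)) \<le> norm (exp D * exp (\<nu> * u - c / 2 * exp u))"
    proof (rule AE_I2)
      fix u
      show "norm (exp (A * exp (\<nu> * u) + \<nu> * u - c * exp u)) \<le> norm (exp D * exp (\<nu> * u - c / 2 * exp u))"
        using D[of u] by (simp add: exp_add[symmetric])
    qed
  qed simp
qed

lemma exp_Complex_split: "exp (Complex u v) = of_real (exp u) * cis v"
  by (simp add: exp_eq_polar)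

lemma borel_measurable_Complex_const [measurable (raw)]:
  assumes "f \<in> borel_measurable M"
  shows "(\<lambda>x. Complex (f x) v) \<in> borel_measurable M"
proof -
  have "(\<lambda>u. Complex u v) \<in> borel_measurable borel"
    by (intro borel_measurable_continuous_onI) (simp add: Complex_eq continuous_intros)
  from measurable_compose[OF assms this] show ?thesis .
qed

text \<open>This is the rotation of the ray in Euler's integral. The integrand is entire with
  modulus \<open>exp (a * u - cos v * exp u)\<close>, and \<open>cos v\<close> is positive on the
  strip, so Cauchy's theorem applies with vanishing vertical sides.\<close>

lemma Gamma_integral_rotated:
  fixes a v0 v1 :: real
  assumes "0 < a" "- (pi / 2) < v0" "v0 < v1" "v1 < pi / 2"
  defines "g \<equiv> \<lambda>w::complex. exp (of_real a * w - exp w)"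
  shows "(LINT u|lborel. g (Complex u v0)) = (LINT u|lborel. g (Complex u v1))"
proof -
  have ng: "norm (g (Complex u v)) = exp (a * u - cos v * exp u)" for u v
    by (simp add: g_def exp_Complex_split mult.commute)
  have [measurable]: "(\<lambda>u. g (Complex u v)) \<in> borel_measurable borel" for v
    unfolding g_def by measurable
  have int: "integrable lborel (\<lambda>u. g (Complex u v))" if "\<bar>v\<bar> < pi / 2" for v
  proof (rule Bochner_Integration.integrable_bound)
    have "0 < cos v" using that by (intro cos_gt_zero_pi) auto
    then show "integrable lborel (\<lambda>u. exp (a * u - cos v * exp u))"
      using has_bochner_integral_exp_exp_Gamma[of a "cos v"] assms by (auto simp: has_bochner_integral_iff)
  qed (simp_all add: ng)
  \<comment> \<open>\<open>cos\<close> is even and decreasing in \<open>\<bar>v\<bar>\<close>, so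
    its minimum over the strip is attained on an edge.\<close>
  define k where "k = min (cos v0) (cos v1)"
  have k: "0 < k" using assms by (auto simp: k_def intro!: cos_gt_zero_pi)
  have kle: "k \<le> cos v" if "v \<in> {v0..v1}" for v
  proof (cases "0 \<le> v")
    case True
    then have "cos v1 \<le> cos v" using that assms by (intro cos_monotone_0_pi_le) auto
    then show ?thesis by (simp add: k_def)
  next
    case False
    then have "cos (- v0) \<le> cos (- v)" using that assms by (intro cos_monotone_0_pi_le) auto
    then show ?thesis by (simp add: k_def)
  qed
  have "(LINT u|lborel. g (Complex u v0)) - (LINT u|lborel. g (Complex u v1)) = 0"
  \<comment> \<open>The first summand of \<open>B\<close> bounds the right side of the rectangle,
    the second the left side.\<close>
  proof (rule horizontal_integral_difference[where B="\<lambda>R. exp (a * R - k * exp R) + exp (- a * R)"])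
    show "\<forall>\<^sub>F R in at_top. (g has_contour_integral 0) (rectpath (Complex (-R) v0) (Complex R v1))"
      by (intro always_eventually allI Cauchy_theorem_convex_simple[of _ UNIV])
        (auto simp: g_def intro!: holomorphic_intros)
    show "((\<lambda>R. exp (a * R - k * exp R) + exp (- a * R)) \<longlongrightarrow> 0) at_top"
      using assms(1) k by real_asymp
    show "\<forall>\<^sub>F R in at_top. \<forall>v\<in>{v0..v1}. norm (g (Complex R v)) \<le> exp (a * R - k * exp R) + exp (- a * R) \<and>
       norm (g (Complex (-R) v)) \<le> exp (a * R - k * exp R) + exp (- a * R)"
    proof (intro always_eventually allI ballI conjI)
      fix R v assume v: "v \<in> {v0..v1}"
      show "norm (g (Complex R v)) \<le> exp (a * R - k * exp R) + exp (- a * R)"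
        using kle[OF v] by (simp add: ng add_increasing2)
      have "0 \<le> cos v" using kle[OF v] k by simp
      then show "norm (g (Complex (-R) v)) \<le> exp (a * R - k * exp R) + exp (- a * R)"
        by (simp add: ng add_increasing)
    qed
  qed (use assms int in auto)
  then show ?thesis by simp
qed

text \<open>The value is \<open>\<Gamma>(a) s^(-a)\<close> with the principal power. On the line at
  height \<open>Im (Ln s)\<close>, shifted by \<open>Re (Ln s)\<close>, the variable is
  \<open>Ln s + u\<close>, whose exponential is \<open>s * exp u\<close>; the rotation lemma moves
  this line to the real axis.\<close>

lemma Gamma_integral_complex_scale:
  fixes a :: real and s :: complex
  assumes a: "0 < a" and s: "0 < Re s"
  shows "has_bochner_integral lborel (\<lambda>u. exp (of_real (a * u) - s * of_real (exp u)))
    (of_real (Gamma a) * exp (- of_real a * Ln s))"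
proof -
  define \<theta> where "\<theta> = Im (Ln s)"
  have s0: "s \<noteq> 0" using s by auto
  have th: "\<bar>\<theta>\<bar> < pi / 2" unfolding \<theta>_def using Re_Ln_pos_lt_imp[OF s] by simp
  define g where "g = (\<lambda>w::complex. exp (of_real a * w - exp w))"
  have [measurable]: "(\<lambda>u. g (Complex u v)) \<in> borel_measurable borel" for v
    unfolding g_def by measurable
  have ng: "norm (g (Complex u v)) = exp (a * u - cos v * exp u)" for u v
    by (simp add: g_def exp_Complex_split mult.commute)
  have int: "integrable lborel (\<lambda>u. g (Complex u \<theta>))"
  proof (rule Bochner_Integration.integrable_bound)
    have "0 < cos \<theta>" using th by (intro cos_gt_zero_pi) auto
    then show "integrable lborel (\<lambda>u. exp (a * u - cos \<theta> * exp u))"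
      using has_bochner_integral_exp_exp_Gamma[of a "cos \<theta>"] assms by (auto simp: has_bochner_integral_iff)
  qed (simp_all add: ng)
  have "g (Complex u 0) = of_real (exp (a * u - exp u))" for u
    by (simp add: g_def Complex_eq exp_of_real of_real_diff flip: of_real_mult of_real_diff)
  then have "(LINT u|lborel. g (Complex u 0)) = of_real (Gamma a)"
    using has_bochner_integral_exp_minus_exp[OF a] by (simp add: has_bochner_integral_iff)
  \<comment> \<open>The rotation lemma takes two strictly ordered heights, so the position of
    \<open>\<theta>\<close> relative to 0 has to be distinguished.\<close>
  moreover consider "\<theta> < 0" | "\<theta> = 0" | "\<theta> > 0" by linarith
  then have "(LINT u|lborel. g (Complex u \<theta>)) = (LINT u|lborel. g (Complex u 0))"
    using Gamma_integral_rotated[of a 0 \<theta>] Gamma_integral_rotated[of a \<theta> 0] th a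
    by cases (simp_all add: g_def)
  ultimately have "has_bochner_integral lborel (\<lambda>u. g (Complex u \<theta>)) (of_real (Gamma a))"
    using int by (simp add: has_bochner_integral_iff)
  then have "has_bochner_integral lborel (\<lambda>u. g (Complex (Re (Ln s) + 1 * u) \<theta>)) (of_real (Gamma a) /\<^sub>R \<bar>1\<bar>)"
    by (subst (asm) lborel_has_bochner_integral_real_affine_iff[of 1 _ _ "Re (Ln s)"]) auto
  then have "has_bochner_integral lborel (\<lambda>u. exp (- of_real a * Ln s) * g (Complex (Re (Ln s) + u) \<theta>))
     (exp (- of_real a * Ln s) * of_real (Gamma a))"
    by (intro has_bochner_integral_mult_right) simp
  moreover have "exp (- of_real a * Ln s) * g (Complex (Re (Ln s) + u) \<theta>) = exp (of_real (a * u) - s * of_real (exp u))" for u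
  proof -
    have w: "Complex (Re (Ln s) + u) \<theta> = Ln s + of_real u"
      by (simp add: \<theta>_def complex_eq_iff)
    have "exp (Ln s + of_real u) = s * of_real (exp u)"
      using s0 by (simp add: exp_add exp_of_real)
    then show ?thesis unfolding g_def w by (simp add: exp_add[symmetric] algebra_simps)
  qed
  ultimately show ?thesis by (simp add: mult.commute)
qed


section \<open>Hankel representation of the M-Wright function\<close>

text \<open>The integrand of the Hankel representation at \<open>\<sigma> = e\<^sup>w\<close>, including the Jacobian \<open>d\<sigma> = e\<^sup>w dw\<close>.\<close>

definition hankel_kernel :: "real \<Rightarrow> real \<Rightarrow> real \<Rightarrow> complex \<Rightarrow> complex" where
  "hankel_kernel \<nu> x t w = exp (of_real t * exp w - of_real x * exp (of_real \<nu> * w) + of_real \<nu> * w)"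

lemma norm_hankel_kernel:
  "norm (hankel_kernel \<nu> x t (Complex u \<theta>))
    = exp (t * cos \<theta> * exp u - x * cos (\<nu> * \<theta>) * exp (\<nu> * u) + \<nu> * u)"
  by (simp add: hankel_kernel_def Re_exp algebra_simps)

lemma borel_measurable_hankel_kernel [measurable]:
  "(\<lambda>u. hankel_kernel \<nu> x t (Complex u \<theta>)) \<in> borel_measurable borel"
  unfolding hankel_kernel_def by measurable

text \<open>The decay of \<open>exp (t * cos \<theta> * exp u)\<close> dominates the
  \<open>exp (\<nu> * u)\<close> term, whatever the sign of its coefficient.\<close>

lemma integrable_hankel_kernel:
  assumes "0 < \<nu>" "\<nu> < 1" "0 < t" "cos \<theta> < 0"
  shows "integrable lborel (\<lambda>u. hankel_kernel \<nu> x t (Complex u \<theta>))"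
proof (rule Bochner_Integration.integrable_bound)
  show "integrable lborel (\<lambda>u. exp (- (x * cos (\<nu> * \<theta>)) * exp (\<nu> * u) + \<nu> * u - (- t * cos \<theta>) * exp u))"
    using assms by (intro integrable_exp_subexponential) (auto intro: mult_pos_neg)
qed (simp_all add: norm_hankel_kernel algebra_simps)

text \<open>The sign \<open>\<sigma>\<close> selects one of the two rays. Negation turns the angle
  \<open>\<sigma> * \<phi>\<close> into \<open>\<sigma> * (\<phi> - pi)\<close>, which lies in the
  principal range.\<close>

lemma Ln_minus_cis:
  assumes "\<sigma> = 1 \<or> \<sigma> = -1" "pi / 2 < \<phi>" "\<phi> < pi" "0 < t"
  shows "Ln (- (of_real t * cis (\<sigma> * \<phi>))) = of_real (ln t) + \<i> * of_real (\<sigma> * (\<phi> - pi))"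
proof (rule Ln_unique)
  have "cis (\<sigma> * (\<phi> - pi)) = - cis (\<sigma> * \<phi>)"
    using assms(1) by (auto simp: complex_eq_iff cos_diff sin_diff)
  then show "exp (of_real (ln t) + \<i> * of_real (\<sigma> * (\<phi> - pi))) = - (of_real t * cis (\<sigma> * \<phi>))"
    using assms(4) by (simp add: exp_add exp_of_real cis_conv_exp[symmetric] del: of_real_mult of_real_diff)
qed (use assms in auto)

text \<open>As \<open>\<phi> > pi / 2\<close>, the scale
  \<open>s = - t * cis (\<sigma> * \<phi>)\<close> has positive real part and the complex Gamma
  integral applies. The phase of \<open>s^(-a)\<close> combines with
  \<open>cis (a * \<sigma> * \<phi>)\<close> into \<open>cis (a * \<sigma> * pi)\<close>, so the
  angle \<open>\<phi>\<close> cancels.\<close>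

lemma hankel_power_integral:
  assumes "\<sigma> = 1 \<or> \<sigma> = -1" "pi / 2 < \<phi>" "\<phi> < pi" "0 < t" "0 < a"
  shows "has_bochner_integral lborel
      (\<lambda>u. exp (of_real t * exp (Complex u (\<sigma> * \<phi>)) + of_real a * Complex u (\<sigma> * \<phi>)))
      (of_real (Gamma a * t powr (-a)) * cis (a * \<sigma> * pi))"
proof -
  define s where "s = - (of_real t * cis (\<sigma> * \<phi>))"
  have "cos (\<sigma> * \<phi>) = cos \<phi>" using assms(1) by auto
  moreover have "cos \<phi> < 0" using assms by (intro cos_lt_zero_pi) auto
  ultimately have "0 < Re s" using assms(4) by (simp add: s_def mult_pos_neg)
  from Gamma_integral_complex_scale[OF assms(5) this]
  have hb: "has_bochner_integral lborel (\<lambda>u. cis (a * \<sigma> * \<phi>) * exp (of_real (a * u) - s * of_real (exp u)))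
    (cis (a * \<sigma> * \<phi>) * (of_real (Gamma a) * exp (- of_real a * Ln s)))"
    by (intro has_bochner_integral_mult_right)
  have e1: "cis (a * \<sigma> * \<phi>) * exp (of_real (a * u) - s * of_real (exp u))
     = exp (of_real t * exp (Complex u (\<sigma> * \<phi>)) + of_real a * Complex u (\<sigma> * \<phi>))" for u
  proof -
    have "exp (of_real t * exp (Complex u (\<sigma> * \<phi>)) + of_real a * Complex u (\<sigma> * \<phi>))
        = exp (of_real t * (of_real (exp u) * cis (\<sigma> * \<phi>))) * exp (of_real a * (of_real u + \<i> * of_real (\<sigma> * \<phi>)))"
      unfolding exp_Complex_split exp_add by (simp add: Complex_eq)
    also have "exp (of_real a * (of_real u + \<i> * of_real (\<sigma> * \<phi>))) = exp (of_real (a * u)) * cis (a * \<sigma> * \<phi>)"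
      by (simp add: cis_conv_exp exp_add[symmetric] algebra_simps)
    finally show ?thesis by (simp add: s_def exp_add algebra_simps)
  qed
  have e2: "cis (a * \<sigma> * \<phi>) * (of_real (Gamma a) * exp (- of_real a * Ln s))
     = of_real (Gamma a * t powr (-a)) * cis (a * \<sigma> * pi)"
  proof -
    have "of_real (t powr (-a)) = exp (- (of_real a * of_real (ln t)) :: complex)"
      using assms(4) by (simp add: powr_def exp_of_real[symmetric])
    then show ?thesis
      unfolding s_def Ln_minus_cis[OF assms(1-4)]
      by (simp add: cis_conv_exp exp_add[symmetric] mult.left_commute[of "exp _"] algebra_simps)
  qed
  show ?thesis using hb unfolding e1 e2 .
qed

text \<open>Expanding \<open>exp (- x * exp (\<nu> * w))\<close> produces
  \<open>exp (\<nu> * n * w)\<close>; together with the factor \<open>exp (\<nu> * w)\<close>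
  already present this gives the exponent \<open>a n\<close>. The interchange holds because the
  moduli of the terms sum to an integrable function.\<close>

lemma hankel_kernel_integral_sums:
  assumes nu: "0 < \<nu>" "\<nu> < 1" and "0 \<le> x" and t: "0 < t"
    and \<sigma>: "\<sigma> = 1 \<or> \<sigma> = -1" and \<phi>: "pi / 2 < \<phi>" "\<phi> < pi"
  defines "a \<equiv> \<lambda>n::nat. \<nu> * (real n + 1)"
  shows "(\<lambda>n. (- of_real x) ^ n / fact n * (of_real (Gamma (a n) * t powr (- a n)) * cis (a n * \<sigma> * pi)))
    sums (LINT u|lborel. hankel_kernel \<nu> x t (Complex u (\<sigma> * \<phi>)))"
proof -
  define c where "c = - t * cos \<phi>"
  have c: "0 < c" unfolding c_def using t cos_lt_zero_pi[OF \<phi>(1)] \<phi> by (simp add: mult_pos_neg)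
  have cs: "cos (\<sigma> * \<phi>) = cos \<phi>" using \<sigma> by auto
  define f where "f n u = (- of_real x) ^ n / fact n *
     exp (of_real t * exp (Complex u (\<sigma> * \<phi>)) + of_real (a n) * Complex u (\<sigma> * \<phi>))" for n u
  have a: "0 < a n" for n using nu by (simp add: a_def)
  have f: "has_bochner_integral lborel (f n)
      ((- of_real x) ^ n / fact n * (of_real (Gamma (a n) * t powr (- a n)) * cis (a n * \<sigma> * pi)))" for n
    unfolding f_def using hankel_power_integral[OF \<sigma> \<phi> t a] by (intro has_bochner_integral_mult_right) simp
  have nf: "norm (f n u) = (x * exp (\<nu> * u)) ^ n /\<^sub>R fact n * exp (\<nu> * u - c * exp u)" for n u
  proof -
    have "norm (f n u) = x ^ n / fact n * exp (t * (exp u * cos \<phi>) + a n * u)"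
      unfolding f_def using assms(3) by (simp add: norm_mult norm_divide norm_power Re_exp cs)
    also have "exp (t * (exp u * cos \<phi>) + a n * u) = exp (\<nu> * u) ^ n * exp (\<nu> * u - c * exp u)"
      by (simp add: exp_of_nat_mult[symmetric] exp_add[symmetric] a_def c_def algebra_simps)
    finally show ?thesis by (simp add: power_mult_distrib divide_inverse)
  qed
  have nfs: "(\<lambda>n. norm (f n u)) sums exp (x * exp (\<nu> * u) + \<nu> * u - c * exp u)" for u
  proof -
    have "(\<lambda>n. norm (f n u)) sums (exp (x * exp (\<nu> * u)) * exp (\<nu> * u - c * exp u))"
      unfolding nf by (intro sums_mult2 exp_converges)
    then show ?thesis by (simp add: exp_add[symmetric] algebra_simps)
  qed
  have sumf: "(\<Sum>n. f n u) = hankel_kernel \<nu> x t (Complex u (\<sigma> * \<phi>))" for u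
  proof -
    define w where "w = Complex u (\<sigma> * \<phi>)"
    have "f n u = (- of_real x * exp (of_real \<nu> * w)) ^ n /\<^sub>R fact n * exp (of_real t * exp w + of_real \<nu> * w)" for n
    proof -
      have "exp (of_real t * exp w + of_real (a n) * w) = exp (of_real \<nu> * w) ^ n * exp (of_real t * exp w + of_real \<nu> * w)"
        by (simp add: exp_of_nat_mult[symmetric] exp_add[symmetric] a_def algebra_simps)
      moreover have "(- (of_real x * exp (of_real \<nu> * w))) ^ n = (- of_real x) ^ n * exp (of_real \<nu> * w) ^ n"
        by (metis minus_mult_left power_mult_distrib)
      ultimately show ?thesis
        by (simp add: f_def w_def[symmetric] divide_inverse scaleR_conv_of_real)
    qed
    then have "(\<lambda>n. f n u) sums (exp (- of_real x * exp (of_real \<nu> * w)) * exp (of_real t * exp w + of_real \<nu> * w))"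
      by (simp only:) (intro sums_mult2 exp_converges)
    then show ?thesis
      by (simp add: sums_iff hankel_kernel_def w_def exp_add[symmetric] algebra_simps)
  qed
  have if_: "integrable lborel (f n)" for n using f[of n] by (simp add: has_bochner_integral_iff)
  have fi: "integral\<^sup>L lborel (f n) = (- of_real x) ^ n / fact n * (of_real (Gamma (a n) * t powr (- a n)) * cis (a n * \<sigma> * pi))" for n
    using f[of n] by (simp add: has_bochner_integral_iff)
  \<comment> \<open>Partial sums of the L1 norms are bounded by the integral of the full sum of
    moduli from \<open>nfs\<close>.\<close>
  have "summable (\<lambda>n. LINT u|lborel. norm (f n u))"
  proof (rule bounded_imp_summable[where B="LINT u|lborel. exp (x * exp (\<nu> * u) + \<nu> * u - c * exp u)"])
    fix n
    have "(\<Sum>k\<le>n. LINT u|lborel. norm (f k u)) = (LINT u|lborel. (\<Sum>k\<le>n. norm (f k u)))"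
      using if_ by (intro Bochner_Integration.integral_sum[symmetric]) auto
    also have "\<dots> \<le> (LINT u|lborel. exp (x * exp (\<nu> * u) + \<nu> * u - c * exp u))"
    proof (rule integral_mono)
      fix u
      show "(\<Sum>k\<le>n. norm (f k u)) \<le> exp (x * exp (\<nu> * u) + \<nu> * u - c * exp u)"
        using nfs[of u] by (metis atMost_atLeast0 finite_atMost norm_ge_zero sum_le_suminf sums_iff)
    qed (use if_ integrable_exp_subexponential[OF c nu, of x] in auto)
    finally show "(\<Sum>k\<le>n. LINT u|lborel. norm (f k u)) \<le> (LINT u|lborel. exp (x * exp (\<nu> * u) + \<nu> * u - c * exp u))" .
  qed simp
  from sums_integral[OF if_ _ this] nfs
  show ?thesis unfolding sumf fi by (auto simp: sums_iff)
qed

text \<open>At \<open>a = \<nu> * (n + 1)\<close> the left side is the coefficient in the series,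
  since \<open>1 - a = - \<nu> * n + (1 - \<nu>)\<close>.\<close>

lemma rGamma_reflection_real:
  assumes "0 < a"
  shows "rGamma (of_real (1 - a)) = (of_real (Gamma a * sin (pi * a) / pi) :: complex)"
proof -
  have "rGamma (of_real a) * rGamma (1 - of_real a) = sin (of_real pi * of_real a) / (of_real pi :: complex)"
    by (rule rGamma_reflection_complex)
  also have "sin (of_real pi * of_real a) = (of_real (sin (pi * a)) :: complex)"
    by (simp add: sin_of_real flip: of_real_mult)
  finally have "of_real (Gamma a) * (of_real (rGamma a) * rGamma (of_real (1 - a))) = (of_real (Gamma a * sin (pi * a) / pi) :: complex)"
    by (simp add: rGamma_complex_of_real)
  moreover have "Gamma a \<noteq> 0" using Gamma_real_pos[OF assms] by linarith
  then have "Gamma a * rGamma a = 1" by (simp add: rGamma_inverse_Gamma)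
  then have "(of_real (Gamma a) * of_real (rGamma a) :: complex) = 1"
    by (simp flip: of_real_mult)
  ultimately show ?thesis by (simp add: mult.assoc[symmetric])
qed

text \<open>Subtracting the two rays turns the phases \<open>cis (\<plusminus> a n * pi)\<close>
  into \<open>2 * \<i> * sin (pi * a n)\<close>, and the reflection formula converts this into
  \<open>rGamma (1 - a n)\<close>. The form \<open>sums\<close> also provides convergence of the
  defining series.\<close>

lemma M_Wright_time_sums:
  assumes nu: "0 < \<nu>" "\<nu> < 1" and x: "0 \<le> x" and t: "0 < t" and \<phi>: "pi / 2 < \<phi>" "\<phi> < pi"
  shows "(\<lambda>n. of_real (t powr (- \<nu>)) * ((- of_real (x / t powr \<nu>)) ^ n / fact n * rGamma (of_real (- \<nu> * real n + (1 - \<nu>)))))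
     sums (((LINT u|lborel. hankel_kernel \<nu> x t (Complex u \<phi>)) -
            (LINT u|lborel. hankel_kernel \<nu> x t (Complex u (-\<phi>)))) / (2 * of_real pi * \<i>))"
proof -
  define a where "a = (\<lambda>n::nat. \<nu> * (real n + 1))"
  have a: "0 < a n" for n using nu by (simp add: a_def)
  define p where "p n = (- of_real x) ^ n / fact n * (of_real (Gamma (a n) * t powr (- a n)) :: complex)" for n
  have s1: "(\<lambda>n. p n * cis (a n * pi)) sums (LINT u|lborel. hankel_kernel \<nu> x t (Complex u \<phi>))"
    using hankel_kernel_integral_sums[OF nu x t _ \<phi>, of 1] by (simp add: p_def a_def mult.assoc)
  have s2: "(\<lambda>n. p n * cis (- (a n * pi))) sums (LINT u|lborel. hankel_kernel \<nu> x t (Complex u (-\<phi>)))"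
    using hankel_kernel_integral_sums[OF nu x t _ \<phi>, of "-1"] by (simp add: p_def a_def mult.assoc)
  have "(\<lambda>n. (p n * cis (a n * pi) - p n * cis (- (a n * pi))) / (2 * of_real pi * \<i>)) sums
     (((LINT u|lborel. hankel_kernel \<nu> x t (Complex u \<phi>)) -
            (LINT u|lborel. hankel_kernel \<nu> x t (Complex u (-\<phi>)))) / (2 * of_real pi * \<i>))"
    by (intro sums_divide sums_diff s1 s2)
  moreover have "(p n * cis (a n * pi) - p n * cis (- (a n * pi))) / (2 * of_real pi * \<i>) =
    of_real (t powr (- \<nu>)) * ((- of_real (x / t powr \<nu>)) ^ n / fact n * rGamma (of_real (- \<nu> * real n + (1 - \<nu>))))" for n
  proof -
    have 1: "cis (a n * pi) - cis (- (a n * pi)) = 2 * \<i> * of_real (sin (pi * a n))"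
      by (simp add: complex_eq_iff mult.commute)
    have "(p n * cis (a n * pi) - p n * cis (- (a n * pi))) / (2 * of_real pi * \<i>) = p n * of_real (sin (pi * a n) / pi)"
      unfolding right_diff_distrib[symmetric] 1 by simp
    also have "\<dots> = (- of_real x) ^ n / fact n * of_real (t powr (- a n)) * rGamma (of_real (1 - a n))"
      unfolding rGamma_reflection_real[OF a] p_def by simp
    also have "1 - a n = - \<nu> * real n + (1 - \<nu>)" by (simp add: a_def algebra_simps)
    also have "t powr (- a n) = t powr (-\<nu>) * (1 / t powr \<nu>) ^ n"
    proof -
      have "(1 / t powr \<nu>) ^ n = t powr (- \<nu> * real n)"
        using t by (simp add: powr_minus_divide[symmetric] powr_realpow[symmetric] powr_powr)
      then show ?thesis by (simp add: powr_add[symmetric] a_def algebra_simps)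
    qed
    also have "of_real (t powr (-\<nu>) * (1 / t powr \<nu>) ^ n) = (of_real (t powr (-\<nu>)) * of_real (1 / t powr \<nu>) ^ n :: complex)"
      by simp
    finally have fin: "(p n * cis (a n * pi) - p n * cis (- (a n * pi))) / (2 * of_real pi * \<i>) =
      (- of_real x) ^ n / fact n * (of_real (t powr (-\<nu>)) * of_real (1 / t powr \<nu>) ^ n) * rGamma (of_real (- \<nu> * real n + (1 - \<nu>)))" .
    have pm: "(- of_real (x / t powr \<nu>)) ^ n = (- of_real x) ^ n * (of_real (1 / t powr \<nu>) ^ n :: complex)"
      by (simp add: power_mult_distrib[symmetric])
    show ?thesis unfolding fin pm by simp
  qed
  ultimately show ?thesis by simp
qed

lemma M_Wright_time_eq_hankel:
  assumes "0 < \<nu>" "\<nu> < 1" "0 \<le> x" "0 < t" "pi / 2 < \<phi>" "\<phi> < pi"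
  shows "M_Wright_time \<nu> x t =
    ((LINT u|lborel. hankel_kernel \<nu> x t (Complex u \<phi>)) -
     (LINT u|lborel. hankel_kernel \<nu> x t (Complex u (-\<phi>)))) / (2 * of_real pi * \<i>)"
proof -
  have s: "summable (\<lambda>n. (- of_real (x / t powr \<nu>)) ^ n / fact n * rGamma (of_real (- \<nu> * real n + (1 - \<nu>)) :: complex))"
    by (rule summable_mult_D[OF sums_summable[OF M_Wright_time_sums[OF assms]]]) (use assms(4) in simp)
  show ?thesis
    using sums_unique[OF M_Wright_time_sums[OF assms]]
    unfolding M_Wright_time_def M_Wright_def by (simp only: suminf_mult[OF s])
qed

lemma isCont_M_Wright:
  assumes "0 < \<nu>" "\<nu> < 1"
  shows "isCont (M_Wright \<nu>) z"
proof -
  define C where "C n = (- 1) ^ n / fact n * rGamma (of_real (- \<nu> * real n + (1 - \<nu>)) :: complex)" for n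
  have phi: "pi / 2 < 3 * pi / 4" "3 * pi / 4 < pi" by auto
  define K where "K = norm z + 1"
  \<comment> \<open>At \<open>t = 1\<close> the Hankel series with \<open>x = K\<close> is the power
    series at \<open>K\<close>. Convergence there, with \<open>K > norm z\<close>, gives continuity
    at \<open>z\<close>.\<close>
  have "C n * of_real K ^ n = of_real (1 powr (- \<nu>)) * ((- of_real (K / 1 powr \<nu>)) ^ n / fact n * rGamma (of_real (- \<nu> * real n + (1 - \<nu>))))" for n
    using power_minus[of "of_real K :: complex" n] by (simp add: C_def)
  then have s: "summable (\<lambda>n. C n * of_real K ^ n)"
    using sums_summable[OF M_Wright_time_sums[OF assms _ zero_less_one phi, of K]] by (simp only:) (simp add: K_def)
  have "isCont (\<lambda>z. \<Sum>n. C n * z ^ n) z"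
    by (rule isCont_powser[OF s]) (simp add: K_def norm_of_real del: of_real_add)
  moreover have "(\<lambda>z. \<Sum>n. C n * z ^ n) = M_Wright \<nu>"
  proof
    fix z :: complex
    have "C n * z ^ n = (- z) ^ n / fact n * rGamma (of_real (- \<nu> * real n + (1 - \<nu>)))" for n
      using power_minus[of z n] by (simp add: C_def)
    then show "(\<Sum>n. C n * z ^ n) = M_Wright \<nu> z" by (simp add: M_Wright_def)
  qed
  ultimately show ?thesis by simp
qed

section \<open>Residue evaluation of the Cauchy integral\<close>

lemma integrable_exp_scaled:
  fixes \<eta> k :: real
  assumes "0 < \<eta>" "0 < k"
  shows "integrable lborel (\<lambda>u. exp (\<eta> * u - k * exp (\<eta> * u)))"
proof -
  have "integrable lborel (\<lambda>u. exp (1 * u - k * exp u))"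
    using has_bochner_integral_exp_exp_Gamma[of 1 k] assms unfolding has_bochner_integral_iff by simp
  then show ?thesis
    using lborel_integrable_real_affine_iff[of \<eta> "\<lambda>u. exp (1 * u - k * exp u)" 0] assms by simp
qed

text \<open>At \<open>t = 0\<close> the decay for large \<open>u\<close> has to come from
  \<open>exp (- x * exp (\<nu> * w))\<close>, hence the condition on
  \<open>cos (\<nu> * \<theta>)\<close>.\<close>

lemma integrable_hankel_kernel_0:
  assumes "0 < \<nu>" "0 < x" "0 < cos (\<nu> * \<theta>)"
  shows "integrable lborel (\<lambda>u. hankel_kernel \<nu> x 0 (Complex u \<theta>))"
proof (rule Bochner_Integration.integrable_bound)
  show "integrable lborel (\<lambda>u. exp (\<nu> * u - x * cos (\<nu> * \<theta>) * exp (\<nu> * u)))"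
    using assms by (intro integrable_exp_scaled) auto
qed (simp_all add: norm_hankel_kernel)

lemma hankel_kernel_split:
  "hankel_kernel \<nu> x t w = hankel_kernel \<nu> x 0 w * exp (of_real t * exp w)"
  by (simp add: hankel_kernel_def exp_add[symmetric] algebra_simps)

lemma cos_mult_le:
  assumes "0 \<le> \<nu>" "\<nu> * \<phi> < pi / 2" "\<bar>v\<bar> \<le> \<phi>"
  shows "cos (\<nu> * \<phi>) \<le> cos (\<nu> * v)"
proof -
  have "cos (\<nu> * \<phi>) \<le> cos \<bar>\<nu> * v\<bar>"
    using assms pi_gt_zero by (intro cos_monotone_0_pi_le) (auto simp: abs_mult intro: mult_left_mono simp del: pi_gt_zero)
  then show ?thesis by (simp add: abs_if split: if_splits)
qed

text \<open>Within the strip \<open>\<bar>Im w\<bar> < pi\<close> the exponential is injective, so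
  \<open>z\<close> is the only zero of the denominator. It is simple with derivative
  \<open>- exp z\<close>, which accounts for the minus sign.\<close>

lemma contour_integral_rectpath_hankel_pole:
  assumes z: "\<bar>Im z\<bar> < \<phi>" and \<phi>: "\<phi> < pi" and R: "\<bar>Re z\<bar> < R"
  shows "((\<lambda>w. hankel_kernel \<nu> x 0 w / (exp z - exp w)) has_contour_integral
      (- (2 * of_real pi * \<i>) * (hankel_kernel \<nu> x 0 z / exp z))) (rectpath (Complex (-R) (-\<phi>)) (Complex R \<phi>))"
    (is "(?g has_contour_integral _) ?p")
proof -
  define S where "S = {w. - pi < Im w} \<inter> {w. Im w < pi}"
  have S: "open S" "connected S" unfolding S_def
    by (auto intro!: open_Int open_halfspace_Im_lt open_halfspace_Im_gt convex_connected convex_Int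
        convex_halfspace_Im_lt convex_halfspace_Im_gt)
  have zS: "z \<in> S" using z \<phi> by (auto simp: S_def)
  have ne: "exp z - exp w \<noteq> 0" if "w \<in> S - {z}" for w
  proof
    assume "exp z - exp w = 0"
    moreover have "\<bar>Im w - Im z\<bar> < 2 * pi" using that zS by (auto simp: S_def)
    ultimately have "w = z" by (metis exp_complex_eqI eq_iff_diff_eq_0)
    then show False using that by simp
  qed
  have hol: "?g holomorphic_on S - {z}"
    using ne unfolding hankel_kernel_def by (intro holomorphic_intros) auto
  have zb: "z \<in> box (Complex (-R) (-\<phi>)) (Complex R \<phi>)"
    using z R by (auto simp: in_box_complex_iff)
  have \<phi>0: "0 < \<phi>" "0 < R" using z R by linarith+
  have cb: "cbox (Complex (-R) (-\<phi>)) (Complex R \<phi>) \<subseteq> S"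
    using \<phi> by (auto simp: in_cbox_complex_iff S_def)
  have pi: "path_image ?p = cbox (Complex (-R) (-\<phi>)) (Complex R \<phi>) - box (Complex (-R) (-\<phi>)) (Complex R \<phi>)"
    using \<phi>0 by (intro path_image_rectpath_cbox_minus_box) auto
  have sub: "path_image ?p \<subseteq> S - {z}" unfolding pi using zb cb by blast
  have "contour_integral ?p ?g = 2 * pi * \<i> * (\<Sum>p\<in>{z}. winding_number ?p p * residue ?g p)"
  proof (rule Residue_theorem[OF S _ hol _ _ sub])
    show "\<forall>w. w \<notin> S \<longrightarrow> winding_number ?p w = 0"
      using cb \<phi>0 by (intro allI impI winding_number_rectpath_outside) auto
  qed auto
  also have "\<dots> = 2 * pi * \<i> * residue ?g z"
    by (simp add: winding_number_rectpath[OF zb])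
  also have "residue ?g z = hankel_kernel \<nu> x 0 z / (- exp z)"
  proof (rule residue_simple_pole_deriv[OF _ _ S(1) S(2) zS])
    show "((\<lambda>w. exp z - exp w) has_field_derivative - exp z) (at z)"
      by (auto intro!: derivative_eq_intros)
  qed (auto simp: hankel_kernel_def intro!: holomorphic_intros)
  finally have "contour_integral ?p ?g = - (2 * of_real pi * \<i>) * (hankel_kernel \<nu> x 0 z / exp z)"
    by simp
  moreover have "?g contour_integrable_on ?p"
    using S by (intro contour_integrable_holomorphic_simple[OF hol _ _ sub]) (auto intro: open_delete)
  ultimately show ?thesis using has_contour_integral_integral by metis
qed

text \<open>In the variable \<open>exp w\<close> this closes the two rays to the right around the
  pole \<open>exp z\<close>. The condition on \<open>\<eta> * \<phi>\<close> keeps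
  \<open>cos (\<eta> * v)\<close> positive throughout the strip, which controls the right side of
  the rectangle; on the left side \<open>exp (\<eta> * w)\<close> decays.\<close>

lemma hankel_stieltjes_integral:
  assumes \<eta>: "0 < \<eta>" "\<eta> * \<phi> < pi / 2" and x: "0 < x" and z: "\<bar>Im z\<bar> < pi / 2"
    and \<phi>: "pi / 2 < \<phi>" "\<phi> < pi"
  shows "(LINT u|lborel. hankel_kernel \<eta> x 0 (Complex u \<phi>) / (exp z - exp (Complex u \<phi>))) -
     (LINT u|lborel. hankel_kernel \<eta> x 0 (Complex u (-\<phi>)) / (exp z - exp (Complex u (-\<phi>))))
     = 2 * of_real pi * \<i> * (hankel_kernel \<eta> x 0 z / exp z)"
proof -
  define g where "g w = hankel_kernel \<eta> x 0 w / (exp z - exp w)" for w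
  define k where "k = cos (\<eta> * \<phi>)"
  have "0 < \<eta> * \<phi>" using \<eta> \<phi> by (intro mult_pos_pos) auto
  then have k: "0 < k" unfolding k_def using \<eta> by (intro cos_gt_zero_pi) auto
  have kle: "k \<le> cos (\<eta> * v)" if "\<bar>v\<bar> \<le> \<phi>" for v
    unfolding k_def using \<eta> that by (intro cos_mult_le) auto
  have Rez: "0 < Re (exp z)" using z by (simp add: Re_exp cos_gt_zero_pi)
  have c\<phi>: "cos \<phi> < 0" using \<phi> by (intro cos_lt_zero_pi) auto
  have int: "integrable lborel (\<lambda>u. g (Complex u \<theta>))" if "\<bar>\<theta>\<bar> = \<phi>" for \<theta>
  proof (rule Bochner_Integration.integrable_bound)
    show "integrable lborel (\<lambda>u. hankel_kernel \<eta> x 0 (Complex u \<theta>) / of_real (Re (exp z)))"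
      using kle[of \<theta>] k that \<eta> x by (intro integrable_divide integrable_hankel_kernel_0) auto
    have "cos \<theta> = cos \<phi>" using that by (auto simp: abs_if split: if_splits)
    \<comment> \<open>The rays lie in the left half-plane and \<open>exp z\<close> in the right one,
      so the denominator is bounded below uniformly in \<open>u\<close>.\<close>
    then have "Re (exp z) \<le> norm (exp z - exp (Complex u \<theta>))" for u
      using complex_Re_le_cmod[of "exp z - exp (Complex u \<theta>)"] c\<phi> mult_pos_neg[OF exp_gt_zero[of u] c\<phi>]
      by (simp add: Re_exp del: exp_gt_zero)
    then have "norm (g (Complex u \<theta>)) \<le> norm (hankel_kernel \<eta> x 0 (Complex u \<theta>) / of_real (Re (exp z)))" for u
      using Rez unfolding g_def norm_divide by (intro frac_le) auto
    then show "AE u in lborel. norm (g (Complex u \<theta>)) \<le> norm (hankel_kernel \<eta> x 0 (Complex u \<theta>) / of_real (Re (exp z)))"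
      by simp
    show "(\<lambda>u. g (Complex u \<theta>)) \<in> borel_measurable lborel"
      unfolding g_def by measurable
  qed
  have "(LINT u|lborel. g (Complex u (-\<phi>))) - (LINT u|lborel. g (Complex u \<phi>))
     = - (2 * of_real pi * \<i>) * (hankel_kernel \<eta> x 0 z / exp z)"
  proof (rule horizontal_integral_difference[where
        B="\<lambda>R. exp (\<eta> * R - x * k * exp (\<eta> * R)) + exp (- \<eta> * R) * (2 / exp (Re z))"])
    show "\<forall>\<^sub>F R in at_top. (g has_contour_integral - (2 * of_real pi * \<i>) * (hankel_kernel \<eta> x 0 z / exp z))
       (rectpath (Complex (-R) (-\<phi>)) (Complex R \<phi>))"
      using eventually_gt_at_top[of "\<bar>Re z\<bar>"]
    proof eventually_elim
      case (elim R)
      then show ?case using z \<phi> unfolding g_def by (intro contour_integral_rectpath_hankel_pole) auto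
    qed
    show "((\<lambda>R. exp (\<eta> * R - x * k * exp (\<eta> * R)) + exp (- \<eta> * R) * (2 / exp (Re z))) \<longlongrightarrow> 0) at_top"
      using \<eta>(1) k x by real_asymp
    \<comment> \<open>By the reverse triangle inequality these two conditions bound the denominator
      below by 1 on the right side and by \<open>exp (Re z) / 2\<close> on the left side.\<close>
    have "\<forall>\<^sub>F R in at_top. exp R \<ge> exp (Re z) + 1" by real_asymp
    moreover have "\<forall>\<^sub>F R in at_top. exp (- R) \<le> exp (Re z) / 2" by real_asymp
    ultimately show "\<forall>\<^sub>F R in at_top. \<forall>v\<in>{-\<phi>..\<phi>}.
       norm (g (Complex R v)) \<le> exp (\<eta> * R - x * k * exp (\<eta> * R)) + exp (- \<eta> * R) * (2 / exp (Re z)) \<and>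
       norm (g (Complex (-R) v)) \<le> exp (\<eta> * R - x * k * exp (\<eta> * R)) + exp (- \<eta> * R) * (2 / exp (Re z))"
    proof eventually_elim
      case (elim R)
      show ?case
      proof (intro ballI conjI)
        fix v assume "v \<in> {-\<phi>..\<phi>}"
        then have kv: "k \<le> cos (\<eta> * v)" by (intro kle) auto
        have "1 \<le> norm (exp z - exp (Complex R v))"
          using norm_triangle_ineq3[of "exp z" "exp (Complex R v)"] elim(1) by (simp)
        moreover have "norm (hankel_kernel \<eta> x 0 (Complex R v)) \<le> exp (\<eta> * R - x * k * exp (\<eta> * R))"
          using kv x by (simp add: norm_hankel_kernel)
        ultimately have "norm (g (Complex R v)) \<le> exp (\<eta> * R - x * k * exp (\<eta> * R)) / 1"
          unfolding g_def norm_divide by (intro frac_le) auto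
        then show "norm (g (Complex R v)) \<le> exp (\<eta> * R - x * k * exp (\<eta> * R)) + exp (- \<eta> * R) * (2 / exp (Re z))"
          by (simp add: add_increasing2)
        have "exp (Re z) / 2 \<le> norm (exp z - exp (Complex (-R) v))"
          using norm_triangle_ineq3[of "exp z" "exp (Complex (-R) v)"] elim(2) by (simp)
        moreover have "0 \<le> x * cos (\<eta> * v) * exp (\<eta> * (-R))" using kv k x by auto
        then have "norm (hankel_kernel \<eta> x 0 (Complex (-R) v)) \<le> exp (- \<eta> * R)"
          by (simp add: norm_hankel_kernel)
        ultimately have "norm (g (Complex (-R) v)) \<le> exp (- \<eta> * R) / (exp (Re z) / 2)"
          unfolding g_def norm_divide by (intro frac_le) auto
        then show "norm (g (Complex (-R) v)) \<le> exp (\<eta> * R - x * k * exp (\<eta> * R)) + exp (- \<eta> * R) * (2 / exp (Re z))"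
          by (simp add: add_increasing)
      qed
    qed
  qed (use \<phi> int in auto)
  then show ?thesis unfolding g_def by (simp add: algebra_simps)
qed

section \<open>Laplace transform of the M-Wright function in time\<close>

text \<open>By Tonelli, joint integrability follows from an integrable majorant of the inner L1
  norms; the Gamma integrals supply such a majorant.\<close>

lemma lborel_Fubini_dominated:
  fixes F :: "real \<Rightarrow> real \<Rightarrow> complex"
  assumes meas: "case_prod F \<in> borel_measurable (lborel \<Otimes>\<^sub>M lborel)"
    and int: "\<And>u. integrable lborel (F u)"
    and le: "\<And>u. (LINT y|lborel. norm (F u y)) \<le> N u" and N: "integrable lborel N"
  shows "integrable lborel (\<lambda>y. LINT u|lborel. F u y)"
    and "(LINT y|lborel. LINT u|lborel. F u y) = (LINT u|lborel. LINT y|lborel. F u y)"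
proof -
  note [measurable] = meas
  have i: "integrable (lborel \<Otimes>\<^sub>M lborel) (case_prod F)"
  proof (rule lborel_pair.Fubini_integrable[OF meas])
    show "integrable lborel (\<lambda>u. LINT y|lborel. norm (case_prod F (u, y)))"
    proof (rule Bochner_Integration.integrable_bound[OF N])
      show "AE u in lborel. norm (LINT y|lborel. norm (case_prod F (u, y))) \<le> norm (N u)"
        using le by (auto intro: order_trans[OF _ abs_ge_self])
    qed measurable
  qed (use int in auto)
  show "integrable lborel (\<lambda>y. LINT u|lborel. F u y)"
    using lborel_pair.integrable_snd[OF i] by simp
  show "(LINT y|lborel. LINT u|lborel. F u y) = (LINT u|lborel. LINT y|lborel. F u y)"
    by (rule lborel_pair.Fubini_integral[OF i])
qed

lemma isCont_M_Wright_time: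
  assumes "0 < \<nu>" "\<nu> < 1" "0 < t"
  shows "isCont (\<lambda>t. M_Wright_time \<nu> x t) t" "isCont (\<lambda>x. M_Wright_time \<nu> x t) x"
  unfolding M_Wright_time_def using assms
  by (auto intro!: continuous_intros continuous_within_compose3[OF isCont_M_Wright])

lemma borel_measurable_M_Wright_time_exp [measurable]:
  assumes "0 < \<nu>" "\<nu> < 1"
  shows "(\<lambda>y. M_Wright_time \<nu> x (exp y)) \<in> borel_measurable borel"
proof (rule borel_measurable_continuous_onI)
  have "isCont (\<lambda>y. M_Wright_time \<nu> x (exp y)) y" for y
    by (rule isCont_o2[OF _ isCont_M_Wright_time(1)]) (use assms in auto)
  then show "continuous_on UNIV (\<lambda>y. M_Wright_time \<nu> x (exp y))"
    by (simp add: continuous_at_imp_continuous_on)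
qed

lemma cos_mult_pos:
  assumes "0 < \<nu>" "\<nu> * \<phi> < pi / 2" "pi / 2 < \<phi>"
  shows "0 < cos (\<nu> * \<phi>)"
proof -
  have "0 < \<nu> * \<phi>" using assms pi_gt_zero by (intro mult_pos_pos) linarith+
  then show ?thesis using assms by (intro cos_gt_zero_pi) auto
qed

text \<open>On both rays \<open>\<bar>exp (- x * exp (\<nu> * w))\<bar> \<le> 1\<close>, since
  \<open>cos (\<nu> * \<phi>)\<close> is positive. What remains is a Gamma integral of scale
  \<open>t * c\<close>, which yields the power of \<open>t\<close>; its singularity at 0 is
  integrable as \<open>\<nu> < 1\<close>.\<close>

lemma M_Wright_time_bound:
  assumes \<nu>: "0 < \<nu>" "\<nu> < 1" and x: "0 < x"
    and \<phi>: "pi / 2 < \<phi>" "\<phi> < pi" "\<nu> * \<phi> < pi / 2"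
  obtains C where "\<And>t. 0 < t \<Longrightarrow> norm (M_Wright_time \<nu> x t) \<le> C * t powr (- \<nu>)"
proof
  fix t :: real assume t: "0 < t"
  define c where "c = - cos \<phi>"
  have c: "0 < c" using \<phi> cos_lt_zero_pi[of \<phi>] by (simp add: c_def)
  define V where "V = Gamma \<nu> * (t * c) powr (- \<nu>)"
  have J: "norm (LINT u|lborel. hankel_kernel \<nu> x t (Complex u \<theta>)) \<le> V" if "\<theta> = \<phi> \<or> \<theta> = - \<phi>" for \<theta>
  proof -
    have cs: "cos \<theta> = - c" "cos (\<nu> * \<theta>) = cos (\<nu> * \<phi>)" using that by (auto simp: c_def)
    have "norm (LINT u|lborel. hankel_kernel \<nu> x t (Complex u \<theta>)) \<le> (LINT u|lborel. exp (\<nu> * u - (t * c) * exp u))"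
    proof (rule Bochner_Integration.integral_norm_bound_integral)
      show "integrable lborel (\<lambda>u. hankel_kernel \<nu> x t (Complex u \<theta>))"
        using \<nu> t c cs by (intro integrable_hankel_kernel) auto
      show "integrable lborel (\<lambda>u. exp (\<nu> * u - (t * c) * exp u))"
        using has_bochner_integral_exp_exp_Gamma[of \<nu> "t * c"] \<nu> t c by (simp add: has_bochner_integral_iff)
      fix u
      have "0 \<le> x * cos (\<nu> * \<phi>) * exp (\<nu> * u)" using cos_mult_pos[OF \<nu>(1) \<phi>(3,1)] x by simp
      then show "norm (hankel_kernel \<nu> x t (Complex u \<theta>)) \<le> exp (\<nu> * u - (t * c) * exp u)"
        by (simp add: norm_hankel_kernel cs)
    qed
    also have "\<dots> = V"
      using has_bochner_integral_exp_exp_Gamma[of \<nu> "t * c"] \<nu> t c by (simp add: has_bochner_integral_iff V_def)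
    finally show ?thesis .
  qed
  have "norm (M_Wright_time \<nu> x t) \<le> (V + V) / (2 * pi)"
    unfolding M_Wright_time_eq_hankel[OF \<nu> less_imp_le[OF x] t \<phi>(1,2)] norm_divide
    using J[of \<phi>] J[of "-\<phi>"] order_trans[OF norm_ge_zero J[of \<phi>]]
    by (intro frac_le order_trans[OF norm_triangle_ineq4] add_mono) (auto simp: norm_mult)
  also have "\<dots> = (Gamma \<nu> * c powr (- \<nu>) / pi) * t powr (- \<nu>)"
    using t c by (simp add: V_def powr_mult field_simps)
  finally show "norm (M_Wright_time \<nu> x t) \<le> (Gamma \<nu> * (- cos \<phi>) powr (- \<nu>) / pi) * t powr (- \<nu>)"
    by (simp add: c_def)
qed

text \<open>\<open>h\<close> stands for a Laplace factor \<open>exp (- s * exp y)\<close> with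
  \<open>Re s = k\<close>, of which only the modulus matters here. The dependence on
  \<open>k\<close> is explicit because the bound is later integrated along a Hankel line on which
  \<open>k\<close> varies.\<close>

lemma M_Wright_time_laplace_norm:
  assumes \<nu>: "0 < \<nu>" "\<nu> < 1" and k: "0 < k"
    and C: "\<And>t. 0 < t \<Longrightarrow> norm (M_Wright_time \<nu> x t) \<le> C * t powr (- \<nu>)"
    and h: "h \<in> borel_measurable borel" "\<And>y. norm (h y) = exp (- k * exp y)"
  shows "integrable lborel (\<lambda>y. of_real (exp y) * M_Wright_time \<nu> x (exp y) * h y)"
    and "(LINT y|lborel. norm (of_real (exp y) * M_Wright_time \<nu> x (exp y) * h y)) \<le> C * Gamma (1 - \<nu>) * k powr (\<nu> - 1)"
proof -
  note [measurable] = borel_measurable_M_Wright_time_exp[OF \<nu>] h(1)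
  have hb: "has_bochner_integral lborel (\<lambda>y. C * exp ((1 - \<nu>) * y - k * exp y)) (C * (Gamma (1 - \<nu>) * k powr (- (1 - \<nu>))))"
    using \<nu> k by (intro has_bochner_integral_mult_right has_bochner_integral_exp_exp_Gamma) auto
  have le: "norm (of_real (exp y) * M_Wright_time \<nu> x (exp y) * h y) \<le> C * exp ((1 - \<nu>) * y - k * exp y)" for y
  proof -
    have "norm (of_real (exp y) * M_Wright_time \<nu> x (exp y) * h y) = exp y * norm (M_Wright_time \<nu> x (exp y)) * exp (- k * exp y)"
      by (simp add: norm_mult h(2))
    also have "\<dots> \<le> exp y * (C * exp y powr (- \<nu>)) * exp (- k * exp y)"
      using C[of "exp y"] by (intro mult_left_mono mult_right_mono) auto
    also have "\<dots> = C * (exp y * exp (- \<nu> * y) * exp (- k * exp y))"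
      by (simp add: powr_def)
    also have "exp y * exp (- \<nu> * y) * exp (- k * exp y) = exp ((1 - \<nu>) * y - k * exp y)"
      by (simp add: exp_add[symmetric] algebra_simps)
    finally show ?thesis .
  qed
  show i: "integrable lborel (\<lambda>y. of_real (exp y) * M_Wright_time \<nu> x (exp y) * h y)"
    by (rule Bochner_Integration.integrable_bound[OF hb[unfolded has_bochner_integral_iff, THEN conjunct1]])
      (use order_trans[OF le abs_ge_self] in auto)
  have "(LINT y|lborel. norm (of_real (exp y) * M_Wright_time \<nu> x (exp y) * h y)) \<le> (LINT y|lborel. C * exp ((1 - \<nu>) * y - k * exp y))"
    using i hb le by (intro integral_mono) (auto simp: has_bochner_integral_iff simp del: norm_mult)
  then show "(LINT y|lborel. norm (of_real (exp y) * M_Wright_time \<nu> x (exp y) * h y)) \<le> C * Gamma (1 - \<nu>) * k powr (\<nu> - 1)"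
    using hb by (auto simp: has_bochner_integral_iff)
qed

text \<open>With \<open>s = exp z\<close> the right side is
  \<open>s^(\<eta> - 1) * exp (- x * s^\<eta>)\<close>. Fubini is applied to each ray separately:
  there \<open>Re (d u) \<ge> Re (exp z) > 0\<close>, and the kernel at \<open>t = 0\<close> is
  integrable.\<close>

lemma M_Wright_time_laplace:
  assumes \<eta>: "0 < \<eta>" "\<eta> < 1" and x: "0 < x" and z: "\<bar>Im z\<bar> < pi / 2"
    and \<phi>: "pi / 2 < \<phi>" "\<phi> < pi" "\<eta> * \<phi> < pi / 2"
  shows "(LINT y|lborel. of_real (exp y) * M_Wright_time \<eta> x (exp y) * exp (- (exp z * of_real (exp y))))
    = hankel_kernel \<eta> x 0 z / exp z"
proof -
  define e where "e y = of_real (exp y) * exp (- (exp z * of_real (exp y)))" for y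
  have [measurable]: "e \<in> borel_measurable borel" unfolding e_def by measurable
  have Rez: "0 < Re (exp z)" using z by (simp add: Re_exp cos_gt_zero_pi)
  define J where "J \<theta> y = (LINT u|lborel. hankel_kernel \<eta> x (exp y) (Complex u \<theta>))" for \<theta> y
  have main: "integrable lborel (\<lambda>y. e y * J \<theta> y) \<and> (LINT y|lborel. e y * J \<theta> y) =
      (LINT u|lborel. hankel_kernel \<eta> x 0 (Complex u \<theta>) / (exp z - exp (Complex u \<theta>)))"
    if "\<theta> = \<phi> \<or> \<theta> = - \<phi>" for \<theta>
  proof -
    have cs: "cos \<theta> < 0" "0 < cos (\<eta> * \<theta>)"
      using that \<phi> cos_mult_pos[OF \<eta>(1) \<phi>(3,1)] cos_lt_zero_pi[of \<phi>] by auto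
    define d where "d u = exp z - exp (Complex u \<theta>)" for u
    have d: "Re (exp z) \<le> Re (d u)" for u
      using mult_pos_neg[OF exp_gt_zero[of u] cs(1)] by (simp add: d_def Re_exp)
    have d0: "0 < Re (d u)" for u using d[of u] Rez by linarith
    define F where "F u y = e y * hankel_kernel \<eta> x (exp y) (Complex u \<theta>)" for u y
    have F: "F u y = hankel_kernel \<eta> x 0 (Complex u \<theta>) * exp (of_real (1 * y) - d u * of_real (exp y))" for u y
      unfolding F_def e_def hankel_kernel_split[of _ _ "exp y"] d_def
      by (simp add: exp_of_real[symmetric] exp_add[symmetric] algebra_simps)
    \<comment> \<open>The Jacobian \<open>exp y\<close> makes this the case \<open>a = 1\<close> of
      the complex Gamma integral, whose value is the Cauchy kernel \<open>1 / d u\<close>.\<close>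
    have hb: "has_bochner_integral lborel (F u) (hankel_kernel \<eta> x 0 (Complex u \<theta>) * (of_real (Gamma 1) * exp (- of_real 1 * Ln (d u))))" for u
      unfolding F by (intro has_bochner_integral_mult_right Gamma_integral_complex_scale d0) simp
    have "d u \<noteq> 0" for u using d0[of u] by auto
    then have Fi: "(LINT y|lborel. F u y) = hankel_kernel \<eta> x 0 (Complex u \<theta>) / d u" for u
      using hb[of u] by (simp add: has_bochner_integral_iff exp_minus divide_inverse)
    have nF: "(LINT y|lborel. norm (F u y)) \<le> norm (hankel_kernel \<eta> x 0 (Complex u \<theta>)) / Re (exp z)" for u
    proof -
      have "norm (F u y) = norm (hankel_kernel \<eta> x 0 (Complex u \<theta>)) * exp (1 * y - Re (d u) * exp y)" for y
        unfolding F by (simp add: norm_mult)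
      then have "(LINT y|lborel. norm (F u y)) = norm (hankel_kernel \<eta> x 0 (Complex u \<theta>)) * (Gamma 1 * Re (d u) powr (-1))"
        using has_bochner_integral_exp_exp_Gamma[OF zero_less_one d0[of u]] by (simp add: has_bochner_integral_iff)
      also have "\<dots> = norm (hankel_kernel \<eta> x 0 (Complex u \<theta>)) / Re (d u)"
        using d0[of u] by (simp add: powr_minus_divide)
      also have "\<dots> \<le> norm (hankel_kernel \<eta> x 0 (Complex u \<theta>)) / Re (exp z)"
        using d[of u] Rez by (intro divide_left_mono mult_pos_pos) auto
      finally show ?thesis .
    qed
    have m: "case_prod F \<in> borel_measurable (lborel \<Otimes>\<^sub>M lborel)"
      unfolding F_def hankel_kernel_def e_def by measurable
    have N: "integrable lborel (\<lambda>u. norm (hankel_kernel \<eta> x 0 (Complex u \<theta>)) / Re (exp z))"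
      using integrable_hankel_kernel_0[OF \<eta>(1) x cs(2)] by auto
    have iF: "integrable lborel (F u)" for u using hb[of u] by (simp add: has_bochner_integral_iff)
    have eJ: "(LINT u|lborel. F u y) = e y * J \<theta> y" for y
      unfolding F_def J_def by simp
    show ?thesis
      using lborel_Fubini_dominated[OF m iF nF N] unfolding eJ Fi d_def by simp
  qed
  have "(LINT y|lborel. of_real (exp y) * M_Wright_time \<eta> x (exp y) * exp (- (exp z * of_real (exp y))))
     = (LINT y|lborel. (e y * J \<phi> y - e y * J (-\<phi>) y) / (2 * of_real pi * \<i>))"
    unfolding M_Wright_time_eq_hankel[OF \<eta> less_imp_le[OF x] exp_gt_zero \<phi>(1,2)] J_def e_def
    by (simp add: algebra_simps)
  also have "\<dots> = ((LINT y|lborel. e y * J \<phi> y) - (LINT y|lborel. e y * J (-\<phi>) y)) / (2 * of_real pi * \<i>)"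
    using main by simp
  also have "\<dots> = hankel_kernel \<eta> x 0 z / exp z"
    using main[of \<phi>] main[of "-\<phi>"] hankel_stieltjes_integral[OF \<eta>(1) \<phi>(3) x z \<phi>(1,2)] by simp
  finally show ?thesis .
qed

section \<open>The subordination formula\<close>

lemma obtain_hankel_angle:
  fixes \<eta> \<beta> :: real
  assumes "\<eta> < 1" "\<beta> < 1"
  obtains \<phi> where "pi / 2 < \<phi>" "\<phi> < pi" "\<eta> * \<phi> < pi / 2" "\<beta> * \<phi> < pi / 2"
proof
  \<comment> \<open>For \<open>0 < m < 1\<close> the angle \<open>pi / (1 + m)\<close> lies between
    \<open>pi / 2\<close> and \<open>pi\<close>, and \<open>m\<close> times it stays below
    \<open>pi / 2\<close>. The entry 1/2 ensures \<open>m > 0\<close>.\<close>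
  define m where "m = max (1/2) (max \<eta> \<beta>)"
  have m: "1/2 \<le> m" "m < 1" "\<eta> \<le> m" "\<beta> \<le> m" using assms by (auto simp: m_def)
  define \<phi> where "\<phi> = pi / (1 + m)"
  show 1: "pi / 2 < \<phi>" unfolding \<phi>_def using m by (intro divide_strict_left_mono) auto
  show "\<phi> < pi" unfolding \<phi>_def using m by (simp add: field_simps)
  have "m * \<phi> < pi / 2" unfolding \<phi>_def using m by (simp add: field_simps)
  moreover have "\<eta> * \<phi> \<le> m * \<phi>" "\<beta> * \<phi> \<le> m * \<phi>"
    using 1 m pi_gt_zero by (intro mult_right_mono; linarith)+
  ultimately show "\<eta> * \<phi> < pi / 2" "\<beta> * \<phi> < pi / 2" by linarith+
qed

text \<open>The orders multiply because the Laplace transform of order \<open>\<eta>\<close> is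
  evaluated at \<open>exp (\<beta> * w)\<close>, and \<open>exp (\<eta> * (\<beta> * w))\<close> is
  the power in the kernel of order \<open>\<eta> * \<beta>\<close>.\<close>

lemma M_Wright_time_subordination_log:
  assumes \<eta>: "0 < \<eta>" "\<eta> < 1" and \<beta>: "0 < \<beta>" "\<beta> < 1" and x: "0 < x" and t: "0 < t"
  shows "has_bochner_integral lborel
    (\<lambda>y. of_real (exp y) * (M_Wright_time \<eta> x (exp y) * M_Wright_time \<beta> (exp y) t)) (M_Wright_time (\<eta> * \<beta>) x t)"
proof -
  obtain \<phi> where \<phi>: "pi / 2 < \<phi>" "\<phi> < pi" and \<eta>\<phi>: "\<eta> * \<phi> < pi / 2" and \<beta>\<phi>: "\<beta> * \<phi> < pi / 2"
    using obtain_hankel_angle[OF \<eta>(2) \<beta>(2)] by blast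
  have \<nu>: "0 < \<eta> * \<beta>" "\<eta> * \<beta> < 1"
    using \<eta> \<beta> mult_strict_mono[of \<eta> 1 \<beta> 1] by auto
  obtain C where C: "\<And>t. 0 < t \<Longrightarrow> norm (M_Wright_time \<eta> x t) \<le> C * t powr (- \<eta>)"
    using M_Wright_time_bound[OF \<eta> x \<phi> \<eta>\<phi>] by blast
  define G where "G y = of_real (exp y) * M_Wright_time \<eta> x (exp y)" for y
  have [measurable]: "G \<in> borel_measurable borel"
    unfolding G_def using borel_measurable_M_Wright_time_exp[OF \<eta>] by measurable
  define J where "J \<theta> y = (LINT u|lborel. hankel_kernel \<beta> (exp y) t (Complex u \<theta>))" for \<theta> y
  have main: "integrable lborel (\<lambda>y. G y * J \<theta> y) \<and>
      (LINT y|lborel. G y * J \<theta> y) = (LINT u|lborel. hankel_kernel (\<eta> * \<beta>) x t (Complex u \<theta>))"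
    if "\<theta> = \<phi> \<or> \<theta> = - \<phi>" for \<theta>
  proof -
    have cs: "cos \<theta> < 0" "0 < cos (\<beta> * \<theta>)"
      using that \<phi> cos_mult_pos[OF \<beta>(1) \<beta>\<phi> \<phi>(1)] cos_lt_zero_pi[of \<phi>] by auto
    define w where "w u = Complex u \<theta>" for u
    define z where "z u = of_real \<beta> * w u" for u
    \<comment> \<open>This is where \<open>\<beta> * \<phi> < pi / 2\<close> enters: the Laplace
      variable \<open>exp (z u)\<close> lies in the right half-plane.\<close>
    have z: "\<bar>Im (z u)\<bar> < pi / 2" for u
      using that \<beta>\<phi> \<beta> \<phi> pi_gt_zero by (auto simp: z_def w_def abs_mult)
    define k where "k u = Re (exp (z u))" for u
    have k_eq: "k u = cos (\<beta> * \<theta>) * exp (\<beta> * u)" for u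
      by (simp add: k_def z_def w_def Re_exp)
    have k: "0 < k u" for u unfolding k_eq using cs by simp
    define A where "A u = exp (of_real t * exp (w u) + z u)" for u
    define h where "h u y = exp (- (exp (z u) * of_real (exp y)))" for u y
    have h: "h u \<in> borel_measurable borel" "norm (h u y) = exp (- k u * exp y)" for u y
      unfolding h_def by (measurable, simp add: k_def)
    define F where "F u y = G y * hankel_kernel \<beta> (exp y) t (Complex u \<theta>)" for u y
    have F: "F u y = A u * (G y * h u y)" for u y
      by (simp add: F_def A_def h_def hankel_kernel_def z_def w_def exp_add exp_diff exp_minus divide_inverse exp_of_real ac_simps)
    have iF: "integrable lborel (F u)" for u
      unfolding F G_def
      by (intro integrable_mult_right M_Wright_time_laplace_norm(1)[OF \<eta> k C h(1)[of u] h(2)[of u]])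
    define B where "B = C * Gamma (1 - \<eta>) * cos (\<beta> * \<theta>) powr (\<eta> - 1)"
    \<comment> \<open>The factor \<open>exp (\<beta> * u)\<close> from \<open>A u\<close> and
      \<open>exp ((\<eta> - 1) * (\<beta> * u))\<close> from the power of \<open>k u\<close> combine
      to \<open>exp (\<eta> * \<beta> * u)\<close>, so the majorant is again a Gamma
      integrand.\<close>
    have nF: "(LINT y|lborel. norm (F u y)) \<le> B * exp (\<eta> * \<beta> * u - (- t * cos \<theta>) * exp u)" for u
    proof -
      have "(LINT y|lborel. norm (F u y)) = norm (A u) * (LINT y|lborel. norm (G y * h u y))"
        unfolding F by (simp add: norm_mult)
      also have "\<dots> \<le> norm (A u) * (C * Gamma (1 - \<eta>) * k u powr (\<eta> - 1))"
        unfolding G_def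
        by (intro mult_left_mono M_Wright_time_laplace_norm(2)[OF \<eta> k C h(1)[of u] h(2)[of u]]) simp_all
      also have "k u powr (\<eta> - 1) = cos (\<beta> * \<theta>) powr (\<eta> - 1) * exp ((\<eta> - 1) * (\<beta> * u))"
        unfolding k_eq using cs by (simp add: powr_mult exp_powr_real mult.commute)
      also have "norm (A u) = exp (t * cos \<theta> * exp u + \<beta> * u)"
        by (simp add: A_def z_def w_def Re_exp algebra_simps)
      also have "exp (t * cos \<theta> * exp u + \<beta> * u) * (C * Gamma (1 - \<eta>) * (cos (\<beta> * \<theta>) powr (\<eta> - 1) * exp ((\<eta> - 1) * (\<beta> * u))))
         = B * (exp (t * cos \<theta> * exp u + \<beta> * u) * exp ((\<eta> - 1) * (\<beta> * u)))"
        by (simp add: B_def)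
      also have "exp (t * cos \<theta> * exp u + \<beta> * u) * exp ((\<eta> - 1) * (\<beta> * u)) = exp (\<eta> * \<beta> * u - (- t * cos \<theta>) * exp u)"
        by (simp add: exp_add[symmetric] algebra_simps)
      finally show ?thesis .
    qed
    have "0 < - t * cos \<theta>" using t cs by (simp add: mult_pos_neg)
    then have N: "integrable lborel (\<lambda>u. B * exp (\<eta> * \<beta> * u - (- t * cos \<theta>) * exp u))"
      using has_bochner_integral_exp_exp_Gamma[OF \<nu>(1)]
      unfolding has_bochner_integral_iff by (intro integrable_mult_right) blast
    have m: "case_prod F \<in> borel_measurable (lborel \<Otimes>\<^sub>M lborel)"
      unfolding F_def hankel_kernel_def by measurable
    have Fi: "(LINT y|lborel. F u y) = hankel_kernel (\<eta> * \<beta>) x t (Complex u \<theta>)" for u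
    proof -
      have "(LINT y|lborel. F u y) = A u * (LINT y|lborel. G y * h u y)"
        unfolding F by simp
      also have "(LINT y|lborel. G y * h u y) = hankel_kernel \<eta> x 0 (z u) / exp (z u)"
        unfolding G_def h_def by (rule M_Wright_time_laplace[OF \<eta> x z \<phi> \<eta>\<phi>])
      also have "A u * (hankel_kernel \<eta> x 0 (z u) / exp (z u)) = hankel_kernel (\<eta> * \<beta>) x t (w u)"
        by (simp add: A_def hankel_kernel_def z_def exp_add exp_diff exp_minus divide_inverse mult.assoc)
      finally show ?thesis by (simp add: w_def)
    qed
    have GJ: "(LINT u|lborel. F u y) = G y * J \<theta> y" for y
      unfolding F_def J_def by simp
    show ?thesis
      using lborel_Fubini_dominated[OF m iF nF N] unfolding GJ Fi by simp
  qed
  have eq: "of_real (exp y) * (M_Wright_time \<eta> x (exp y) * M_Wright_time \<beta> (exp y) t)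
     = (G y * J \<phi> y - G y * J (-\<phi>) y) / (2 * of_real pi * \<i>)" for y
    unfolding M_Wright_time_eq_hankel[OF \<beta> exp_ge_zero t \<phi>] J_def G_def
    by (simp add: algebra_simps)
  show ?thesis
    unfolding eq M_Wright_time_eq_hankel[OF \<nu> less_imp_le[OF x] t \<phi>] has_bochner_integral_iff
    using main by simp
qed

theorem mainTheorem2:
  fixes \<nu> \<eta> \<beta> x t :: real
  assumes "0 < \<nu>" "\<nu> < 1"
    and "0 < \<eta>" "\<eta> < 1"
    and "0 < \<beta>" "\<beta> < 1"
    and "\<nu> = \<eta> * \<beta>"
    and "0 < x" "0 < t"
  shows "set_integrable lborel {0<..} (\<lambda>\<tau>. M_Wright_time \<eta> x \<tau> * M_Wright_time \<beta> \<tau> t) \<and>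
    M_Wright_time \<nu> x t =
      (LINT \<tau>:{0<..}|lborel. M_Wright_time \<eta> x \<tau> * M_Wright_time \<beta> \<tau> t)"
proof -
  have c: "continuous_on {0<..} (\<lambda>\<tau>. M_Wright_time \<eta> x \<tau> * M_Wright_time \<beta> \<tau> t)"
    by (intro continuous_at_imp_continuous_on ballI continuous_mult isCont_M_Wright_time) (use assms in auto)
  have "has_bochner_integral lborel
    (\<lambda>y. of_real (exp y) * (M_Wright_time \<eta> x (exp y) * M_Wright_time \<beta> (exp y) t)) (M_Wright_time \<nu> x t)"
    unfolding assms(7) by (intro M_Wright_time_subordination_log assms)
  \<comment> \<open>Undoing \<open>\<tau> = exp y\<close> returns both integrability and value to
    the half-line.\<close>
  then show ?thesis
    using set_integral_exp_subst[OF c] by (simp add: has_bochner_integral_iff)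
qed

end
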